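(* Let $G=(V,E)$ be a graph with $|V|=n$ vertices, and let $X(G)$ be its flag complex. For $k\ge 1$, $$k\,\mu_k(G)\;\ge\;(k+1)\,\mu_{k-1}(G)-n ,$$ where $\mu_k(G)$ denotes the minimal eigenvalue of the reduced $k$-dimensional Laplacian $\Delta_k$ of $X(G)$.
   Context: The flag complex $X(G)$ of a graph $G=(V,E)$ is the simplicial complex on the vertex set $V$ whose simplices are all subsets $\sigma\subset V$ which form a complete subgraph of $G$. For a finite simplicial complex $X$ on the vertex set $V$, $X(k)$ is the set of $k$-dimensional simplices in $X$, each taken with an arbitrary but fixed orientation. For $k\ge 0$, $C^k(X)$ is the space of real valued simplicial $k$-cochains, i.e. real valued skew-symmetric functions on all ordered $k$-simplices of $X$; and $C^{-1}(X)=\mathbb{R}$. The coboundary operator $d_k:C^k(X)\to C^{k+1}(X)$ is, for $k\ge 0$, $$d_k\phi([v_0,\dots,v_{k+1}])=\sum_{i=0}^{k+1}(-1)^i\phi([v_0,\dots,\widehat{v_i},\dots,v_{k+1}]),$$ and $d_{-1}:C^{-1}(X)\to C^0(X)$ is given by $d_{-1}(a)(v)=a$ for $a\in\mathbb{R}$, $v\in V$. Each $C^k(X)$, $k\ge -1$, carries the standard inner product $(\phi,\psi)=\sum_{\sigma\in X(k)}\phi(\sigma)\psi(\sigma)$ (for $k=-1$, the usual product on $\mathbb{R}$), and $d_k^*:C^{k+1}(X)\to C^k(X)$ is the adjoint of $d_k$ with respect to these inner products. For $k\ge 0$ the reduced $k$-dimensional Laplacian of $X$ is $\Delta_k=d_{k-1}d_{k-1}^*+d_k^*d_k:C^k(X)\to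 C^k(X)$. For $X=X(G)$, $\mu_k(G)$ denotes the minimal eigenvalue of $\Delta_k$. *)

theory Defs
  imports
    "Graph_Theory.Digraph"
    "HOL-Combinatorics.Permutations"
    "HOL-Library.Extended_Real"
begin

text \<open>A simplicial complex is given by its set of simplices, including the empty one. Dimensions
  are integers, so that \<open>k = -1\<close> is available.\<close>

definition flag_complex :: "('a, 'b) pre_digraph \<Rightarrow> 'a set set" where
  "flag_complex G =
     {\<sigma>. \<sigma> \<subseteq> verts G \<and> (\<forall>u\<in>\<sigma>. \<forall>v\<in>\<sigma>. u \<noteq> v \<longrightarrow> u \<rightarrow>\<^bsub>G\<^esub> v)}"

definition simplices :: "'a set set \<Rightarrow> int \<Rightarrow> 'a set set" where
  "simplices X k = {\<sigma> \<in> X. finite \<sigma> \<and> int (card \<sigma>) = k + 1}"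

definition ordered_simplices :: "'a set set \<Rightarrow> int \<Rightarrow> 'a list set" where
  "ordered_simplices X k = {vs. distinct vs \<and> set vs \<in> X \<and> int (length vs) = k + 1}"

text \<open>Cochains are extended by \<open>0\<close> to all lists, so that equality of cochains is equality of
  functions. The only ordered simplex of dimension \<open>-1\<close> is \<open>[]\<close>; hence
  \<open>cochains X (-1)\<close> is a copy of the reals, via \<open>\<phi> \<mapsto> \<phi> []\<close>.\<close>

definition cochains :: "'a set set \<Rightarrow> int \<Rightarrow> ('a list \<Rightarrow> real) set" where
  "cochains X k =
     {\<phi>. (\<forall>vs. vs \<notin> ordered_simplices X k \<longrightarrow> \<phi> vs = 0) \<and>
         (\<forall>vs \<in> ordered_simplices X k. \<forall>p. p permutes {..<length vs} \<longrightarrow>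
            \<phi> (permute_list p vs) = of_int (sign p) * \<phi> vs)}"

text \<open>For \<open>k = -1\<close> the sum below is the single term \<open>\<phi> []\<close>, so the coboundary takes the
  number \<open>a\<close> to the constant function \<open>a\<close> on the vertices.\<close>

definition coboundary ::
    "'a set set \<Rightarrow> int \<Rightarrow> ('a list \<Rightarrow> real) \<Rightarrow> 'a list \<Rightarrow> real" where
  "coboundary X k \<phi> vs =
     (if vs \<in> ordered_simplices X (k + 1)
      then \<Sum>i<length vs. (- 1) ^ i * \<phi> (take i vs @ drop (Suc i) vs)
      else 0)"

text \<open>The arbitrary but fixed orientation of each simplex.\<close>

definition orientation :: "'a set \<Rightarrow> 'a list" where
  "orientation \<sigma> = (SOME vs. distinct vs \<and> set vs = \<sigma>)"

definition cochain_inner ::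
    "'a set set \<Rightarrow> int \<Rightarrow> ('a list \<Rightarrow> real) \<Rightarrow> ('a list \<Rightarrow> real) \<Rightarrow> real" where
  "cochain_inner X k \<phi> \<psi> =
     (\<Sum>\<sigma>\<in>simplices X k. \<phi> (orientation \<sigma>) * \<psi> (orientation \<sigma>))"

definition coboundary_adjoint ::
    "'a set set \<Rightarrow> int \<Rightarrow> ('a list \<Rightarrow> real) \<Rightarrow> 'a list \<Rightarrow> real" where
  "coboundary_adjoint X k \<psi> =
     (THE \<chi>. \<chi> \<in> cochains X k \<and>
        (\<forall>\<phi> \<in> cochains X k.
           cochain_inner X (k + 1) (coboundary X k \<phi>) \<psi> = cochain_inner X k \<phi> \<chi>))"

definition laplacian ::
    "'a set set \<Rightarrow> int \<Rightarrow> ('a list \<Rightarrow> real) \<Rightarrow> 'a list \<Rightarrow> real" where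
  "laplacian X k \<phi> = (\<lambda>vs.
     coboundary X (k - 1) (coboundary_adjoint X (k - 1) \<phi>) vs +
     coboundary_adjoint X k (coboundary X k \<phi>) vs)"

definition laplacian_eigenvalues :: "'a set set \<Rightarrow> int \<Rightarrow> real set" where
  "laplacian_eigenvalues X k =
     {\<mu>. \<exists>\<phi> \<in> cochains X k. \<phi> \<noteq> (\<lambda>vs. 0) \<and> laplacian X k \<phi> = (\<lambda>vs. \<mu> * \<phi> vs)}"

text \<open>If \<open>X\<close> has no \<open>k\<close>-simplices, the cochain space is zero and there are no eigenvalues;
  the minimum over the empty set is then \<open>\<infinity>\<close>.\<close>

definition min_laplacian_eigenvalue :: "('a, 'b) pre_digraph \<Rightarrow> int \<Rightarrow> ereal" where
  "min_laplacian_eigenvalue G k =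
     (let S = laplacian_eigenvalues (flag_complex G) k
      in if S = {} then \<infinity> else ereal (Min S))"

end

theory Submission
  imports Defs
    "HOL-Combinatorics.Multiset_Permutations"
    "HOL-Analysis.Function_Topology"
begin

text \<open>The inequality comes from cutting a \<open>k\<close>-cochain \<open>\<phi>\<close> into the \<open>(k - 1)\<close>-cochains
  \<open>\<phi>\<^sub>u ws = \<phi> (u # ws)\<close>, one for each vertex \<open>u\<close>, and comparing the energies
  \<open>(\<Delta>\<phi>\<^sub>u, \<phi>\<^sub>u)\<close> with \<open>(\<Delta>\<phi>, \<phi>)\<close>. Every sum over oriented simplices is replaced by a sum over ordered
  ones, which only multiplies it by a factorial.

  The adjoint of the coboundary is \<open>(d\<^sup>*\<psi>) ws = (\<Sum>v. \<psi> (v # ws))\<close>. In \<open>d d\<^sup>* + d\<^sup>* d\<close> the terms in which a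
  new vertex \<open>v\<close> replaces an entry of \<open>vs\<close> cancel whenever \<open>v # vs\<close> is a simplex, so that
  (\<open>laplacian_pointwise\<close>) each \<open>v\<close> contributes \<open>\<phi> vs\<close> to \<open>(\<Delta>\<phi>) vs\<close> if \<open>v # vs\<close> is a simplex, and
  \<open>\<Sum>i. \<phi> (vs[i := v])\<close> otherwise.
  The energy of \<open>\<phi>\<close> is therefore a degree part
  \<open>\<Sum>vs. deg vs * (\<phi> vs)\<^sup>2\<close> plus an exchange part, which is \<open>k + 1\<close> times the sum \<open>R\<close> of
  \<open>\<phi> vs * \<phi> (vs[0 := v])\<close> over the \<open>v\<close> for which \<open>v # vs\<close> is not a simplex: since \<open>\<phi>\<close> is
  alternating, exchanging at any other position gives the same sum.

  Summed over \<open>u\<close>, the energies of the \<open>\<phi>\<^sub>u\<close> have a degree part in which \<open>deg vs\<close> is replaced by the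
  degree of a facet of \<open>vs\<close>, and the exchange part \<open>k R\<close>; the flag condition is what makes the same
  pairs \<open>(vs, v)\<close> appear in it (\<open>restrict_laplacian_form\<close>). In \<open>k + 1\<close> times this sum minus \<open>k\<close>
  times the energy of \<open>\<phi>\<close> the exchange parts cancel, and there remains
  \<open>\<Sum>vs. (\<phi> vs)\<^sup>2 * ((\<Sum>i. deg (omit i vs)) - k * deg vs)\<close>. In a flag complex a vertex that extends two
  facets of a simplex to simplices extends the whole simplex, so each vertex adds at most
  \<open>1\<close> to the bracket and the bracket is at most \<open>n\<close>
  (\<open>facet_degrees\<close>, \<open>restrict_energy_bound\<close>).

  Taking for \<open>\<phi>\<close> an eigenvector of the smallest eigenvalue and bounding the energy of each \<open>\<phi>\<^sub>u\<close> below
  by \<open>\<mu>\<^bsub>k-1\<^esub>\<close> gives the theorem. This last bound is the variational principle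
  (\<open>rayleigh_minimum\<close>); that the minimum over all eigenvalues is a
  meaningful number needs that they are finite in number (\<open>finite_eigenvalues\<close>).
  If there are no \<open>k\<close>-simplices, then \<open>\<mu>\<^sub>k\<close> is infinite.\<close>

section \<open>The smallest eigenvalue of a symmetric operator\<close>

text \<open>Bessel's inequality for the point masses: once normalised, a finite orthogonal family \<open>(f e)\<close>
  satisfies \<open>\<Sum>e. (f e x)\<^sup>2 \<le> 1\<close> at each point \<open>x\<close>. Summing over \<open>x \<in> F\<close> bounds the size of the
  family by \<open>card F\<close>.\<close>

lemma finite_eigenvalues:
  fixes f :: "real \<Rightarrow> 'b \<Rightarrow> real"
  assumes F: "finite F"
    and nz: "\<And>e. e \<in> E \<Longrightarrow> (\<Sum>x\<in>F. (f e x)\<^sup>2) > 0"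
    and orth: "\<And>d e. d \<in> E \<Longrightarrow> e \<in> E \<Longrightarrow> d \<noteq> e \<Longrightarrow> (\<Sum>x\<in>F. f d x * f e x) = 0"
  shows "finite E"
proof (rule ccontr)
  assume "infinite E"
  then obtain B where B: "B \<subseteq> E" "finite B" "card B = Suc (card F)"
    using infinite_arbitrarily_large by blast
  define N where "N e = (\<Sum>x\<in>F. (f e x)\<^sup>2)" for e
  have N: "N e > 0" if "e \<in> B" for e
    using nz B(1) that by (auto simp: N_def)
  have bessel: "(\<Sum>e\<in>B. (f e x)\<^sup>2 / N e) \<le> 1" if "x \<in> F" for x
  proof -
    define s where "s = (\<Sum>e\<in>B. (f e x)\<^sup>2 / N e)"
    \<comment> \<open>\<open>g\<close> is the projection of the point mass at \<open>x\<close> to the span of the family.\<close>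
    define g where "g y = (\<Sum>e\<in>B. f e x / N e * f e y)" for y
    have "(\<Sum>y\<in>F. (g y)\<^sup>2)
        = (\<Sum>y\<in>F. \<Sum>d\<in>B. \<Sum>e\<in>B. (f d x / N d) * (f e x / N e) * (f d y * f e y))"
      by (simp add: g_def power2_eq_square sum_product algebra_simps)
    also have "\<dots> = (\<Sum>d\<in>B. \<Sum>e\<in>B. (f d x / N d) * (f e x / N e) * (\<Sum>y\<in>F. f d y * f e y))"
      by (subst sum.swap, rule sum.cong[OF refl], subst sum.swap) (simp add: sum_distrib_left)
    also have "\<dots> = (\<Sum>d\<in>B. \<Sum>e\<in>B. if e = d then (f d x)\<^sup>2 / N d else 0)"
    proof (intro sum.cong refl)
      fix d e assume de: "d \<in> B" "e \<in> B"
      show "(f d x / N d) * (f e x / N e) * (\<Sum>y\<in>F. f d y * f e y)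
          = (if e = d then (f d x)\<^sup>2 / N d else 0)"
      proof (cases "e = d")
        case True
        have "(\<Sum>y\<in>F. f d y * f d y) = N d" by (simp add: N_def power2_eq_square)
        then show ?thesis using True N[OF de(1)] by (simp add: power2_eq_square)
      next
        case False
        then show ?thesis using orth[of d e] de B(1) by auto
      qed
    qed
    also have "\<dots> = s" using B(2) by (simp add: s_def)
    finally have "(\<Sum>y\<in>F. (g y)\<^sup>2) = s" .
    moreover have "g x = s" by (simp add: g_def s_def power2_eq_square)
    moreover have "(g x)\<^sup>2 \<le> (\<Sum>y\<in>F. (g y)\<^sup>2)"
      using member_le_sum[of x F "\<lambda>y. (g y)\<^sup>2"] that F by simp
    ultimately have "s * s \<le> s * 1" by (simp add: power2_eq_square)
    then show ?thesis unfolding s_def[symmetric]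
      by (meson leI less_trans mult_less_cancel_left_pos not_le zero_less_one)
  qed
  have "real (card B) = (\<Sum>e\<in>B. (\<Sum>x\<in>F. (f e x)\<^sup>2) / N e)"
    using N by (auto simp: N_def[symmetric] simp: less_imp_neq[symmetric])
  also have "\<dots> = (\<Sum>x\<in>F. \<Sum>e\<in>B. (f e x)\<^sup>2 / N e)"
    by (subst sum.swap) (simp add: sum_divide_distrib)
  also have "\<dots> \<le> (\<Sum>x\<in>F. 1)" by (rule sum_mono) (rule bessel)
  finally show False using B(3) by simp
qed

lemma linear_term_zero:
  fixes a b :: real
  assumes "\<And>t. 0 \<le> a * t + b * t\<^sup>2"
  shows "a = 0"
proof (rule ccontr)
  assume a: "a \<noteq> 0"
  define B where "B = \<bar>b\<bar> + 1"
  have B: "B > 0" "b < B" by (auto simp: B_def)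
  \<comment> \<open>A small step against the sign of \<open>a\<close>; it is so small that the quadratic term cannot compensate.\<close>
  have "a * (- a / B) + b * (- a / B)\<^sup>2 = a\<^sup>2 * (b - B) / B\<^sup>2"
    using B(1) by (simp add: field_simps power2_eq_square)
  also have "\<dots> < 0" using a B by (auto intro!: divide_neg_pos mult_pos_neg)
  finally show False using assms[of "- a / B"] by simp
qed

text \<open>This compactness is what replaces the finite dimension of the space of functions supported on a
  finite set, in the product topology.\<close>

lemma compact_supported_box:
  fixes F :: "'b set"
  shows "compact {f :: 'b \<Rightarrow> real. (\<forall>x\<in>F. \<bar>f x\<bar> \<le> 1) \<and> (\<forall>x. x \<notin> F \<longrightarrow> f x = 0)}"
proof -
  let ?S = "\<lambda>x. if x \<in> F then {-1..1} else {0::real}"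
  have "f \<in> PiE UNIV ?S \<longleftrightarrow> (\<forall>x\<in>F. \<bar>f x\<bar> \<le> 1) \<and> (\<forall>x. x \<notin> F \<longrightarrow> f x = 0)" for f
  proof -
    have "f \<in> PiE UNIV ?S \<longleftrightarrow> (\<forall>x. f x \<in> ?S x)"
      by (simp add: PiE_UNIV_domain Pi_iff)
    also have "\<dots> \<longleftrightarrow> (\<forall>x. if x \<in> F then \<bar>f x\<bar> \<le> 1 else f x = 0)"
      by (intro all_cong1) (auto simp: abs_le_iff)
    finally show ?thesis by auto
  qed
  then have "{f :: 'b \<Rightarrow> real. (\<forall>x\<in>F. \<bar>f x\<bar> \<le> 1) \<and> (\<forall>x. x \<notin> F \<longrightarrow> f x = 0)} = PiE UNIV ?S"
    by blast
  moreover have "compactin (product_topology (\<lambda>_. euclidean) UNIV) (PiE UNIV ?S)"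
    by (subst compactin_PiE) auto
  ultimately show ?thesis by (simp add: euclidean_product_topology)
qed

text \<open>On the compact unit sphere of \<open>C\<close> the form \<open>(f, L f)\<close> attains its minimum \<open>\<mu>\<close>, at some \<open>f\<close>, and
  by homogeneity \<open>(g, L g) - \<mu> (g, g) \<ge> 0\<close> on \<open>C\<close>. This form vanishes at \<open>f\<close>, so its derivative at \<open>f\<close>
  in every direction of \<open>C\<close> vanishes, in particular in the direction \<open>L f - \<mu> f\<close>; hence \<open>f\<close> is an
  eigenvector. Linearity of \<open>L\<close> on \<open>C\<close> follows from its symmetry.\<close>

lemma rayleigh_minimum:
  fixes C :: "('b \<Rightarrow> real) set" and L :: "('b \<Rightarrow> real) \<Rightarrow> ('b \<Rightarrow> real)"
  defines "ip \<equiv> \<lambda>F f g. \<Sum>x\<in>F. f x * g x"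
  assumes F: "finite F"
    and C: "closed C"
    and supp: "\<And>f x. f \<in> C \<Longrightarrow> x \<notin> F \<Longrightarrow> f x = 0"
    and comb: "\<And>f g c. f \<in> C \<Longrightarrow> g \<in> C \<Longrightarrow> (\<lambda>x. f x + c * g x) \<in> C"
    and L: "\<And>f. f \<in> C \<Longrightarrow> L f \<in> C"
    and sym: "\<And>f g. f \<in> C \<Longrightarrow> g \<in> C \<Longrightarrow> ip F (L f) g = ip F f (L g)"
    and cont: "\<And>x. continuous_on C (\<lambda>f. L f x)"
    and h: "h \<in> C" "h \<noteq> (\<lambda>x. 0)"
  obtains \<mu> f where "f \<in> C" "f \<noteq> (\<lambda>x. 0)" "L f = (\<lambda>x. \<mu> * f x)"
    and "\<And>g. g \<in> C \<Longrightarrow> \<mu> * ip F g g \<le> ip F g (L g)"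
proof -
  have ipR: "ip F f (\<lambda>x. g x + c * k x) = ip F f g + c * ip F f k" for f g k c
    by (simp add: ip_def sum.distrib sum_distrib_left algebra_simps)
  have ipC: "ip F f g = ip F g f" for f g
    by (simp add: ip_def mult.commute)
  have ip0: "f = (\<lambda>x. 0)" if "f \<in> C" "ip F f f = 0" for f
  proof
    fix x
    show "f x = 0"
    proof (cases "x \<in> F")
      case True
      then show ?thesis
        using that(2) F by (simp add: ip_def sum_nonneg_eq_0_iff)
    qed (use supp that in auto)
  qed
  have ipnn: "ip F f f \<ge> 0" for f by (simp add: ip_def sum_nonneg)
  have zero: "(\<lambda>x. 0) \<in> C" using comb[OF h(1) h(1), of "-1"] by simp
  have scale: "(\<lambda>x. c * f x) \<in> C" if "f \<in> C" for c f
    using comb[OF zero that, of c] by simp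
  define S where "S = {f \<in> C. ip F f f = 1}"
  have coord: "continuous_on A (\<lambda>f::'b\<Rightarrow>real. f x)" for x A
    by (rule continuous_on_subset[OF continuous_on_product_coordinates]) simp
  have "closed {f :: 'b \<Rightarrow> real. ip F f f = 1}"
    unfolding ip_def by (intro closed_Collect_eq continuous_intros coord)
  then have "closed S" using C by (simp add: S_def Collect_conj_eq closed_Int)
  moreover have "S \<subseteq> {f. (\<forall>x\<in>F. \<bar>f x\<bar> \<le> 1) \<and> (\<forall>x. x \<notin> F \<longrightarrow> f x = 0)}"
  proof (safe)
    fix f x assume f: "f \<in> S" and "x \<in> F"
    then have "f x * f x \<le> 1"
      using member_le_sum[of x F "\<lambda>x. f x * f x"] F by (simp add: S_def ip_def)
    then show "\<bar>f x\<bar> \<le> 1" using abs_square_le_1[of "f x"] by (simp add: power2_eq_square)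
  qed (use supp in \<open>auto simp: S_def\<close>)
  ultimately have "compact S"
    using compact_Int_closed[OF compact_supported_box, of S F] by (simp add: Int_absorb1)
  have normalise: "(\<lambda>x. (1 / sqrt (ip F g g)) * g x) \<in> S" if g: "g \<in> C" "g \<noteq> (\<lambda>x. 0)" for g
  proof -
    have pos: "ip F g g > 0" using ip0[OF g(1)] g(2) ipnn[of g] by fastforce
    have "ip F (\<lambda>x. c * g x) (\<lambda>x. c * g x) = c\<^sup>2 * ip F g g" for c
      by (simp add: ip_def sum_distrib_left power2_eq_square algebra_simps)
    also have "(1 / sqrt (ip F g g))\<^sup>2 * ip F g g = 1" using pos by (simp add: power_divide)
    finally show ?thesis unfolding S_def using scale[OF g(1)] by blast
  qed
  have "S \<noteq> {}" using normalise[OF h] by blast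
  moreover have "continuous_on S (\<lambda>f. ip F f (L f))"
    unfolding ip_def by (intro continuous_intros coord continuous_on_subset[OF cont]) (auto simp: S_def)
  ultimately obtain f where f: "f \<in> S" and min: "\<And>g. g \<in> S \<Longrightarrow> ip F f (L f) \<le> ip F g (L g)"
    using continuous_attains_inf[OF \<open>compact S\<close>] by blast
  define \<mu> where "\<mu> = ip F f (L f)"
  have fC: "f \<in> C" and f1: "ip F f f = 1" using f by (auto simp: S_def)
  have expand: "ip F (\<lambda>x. u x + c * v x) (L (\<lambda>x. u x + c * v x))
      = ip F u (L u) + 2 * c * ip F v (L u) + c\<^sup>2 * ip F v (L v)"
    if "u \<in> C" "v \<in> C" for u v c
  proof -
    let ?w = "\<lambda>x. u x + c * v x"
    have w: "?w \<in> C" using comb that by blast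
    have "ip F ?w (L ?w) = ip F (L ?w) u + c * ip F (L ?w) v"
      by (subst ipC) (rule ipR)
    also have "\<dots> = ip F (L u) ?w + c * ip F (L v) ?w"
      using sym[OF w that(1)] sym[OF w that(2)] by (simp add: ipC)
    also have "\<dots> = ip F (L u) u + c * ip F (L u) v + c * (ip F (L v) u + c * ip F (L v) v)"
      by (simp add: ipR)
    also have "ip F (L v) u = ip F (L u) v"
      using sym[OF that] by (simp add: ipC)
    finally show ?thesis by (simp add: ipC power2_eq_square algebra_simps)
  qed
  have bound: "\<mu> * ip F g g \<le> ip F g (L g)" if g: "g \<in> C" for g
  proof (cases "g = (\<lambda>x. 0)")
    case True
    then show ?thesis by (simp add: ip_def)
  next
    case False
    have pos: "ip F g g > 0" using ip0[OF g] False ipnn[of g] by fastforce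
    define c where "c = 1 / sqrt (ip F g g)"
    have "\<mu> \<le> ip F (\<lambda>x. c * g x) (L (\<lambda>x. c * g x))"
      using min[OF normalise[OF g False]] by (simp add: \<mu>_def c_def)
    also have "\<dots> = c\<^sup>2 * ip F g (L g)"
      using expand[OF zero g, of c] sym[OF g zero] by (simp add: ip_def)
    also have "\<dots> = ip F g (L g) / ip F g g" using pos by (simp add: c_def power_divide)
    finally show ?thesis using pos by (simp add: field_simps)
  qed
  have crit: "ip F g (L f) = \<mu> * ip F f g" if g: "g \<in> C" for g
  proof -
    have "0 \<le> (2 * ip F g (L f) - 2 * \<mu> * ip F f g) * t + (ip F g (L g) - \<mu> * ip F g g) * t\<^sup>2" for t
    proof -
      let ?w = "\<lambda>x. f x + t * g x"
      have "ip F ?w ?w = ip F ?w f + t * ip F ?w g" by (rule ipR)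
      also have "\<dots> = ip F f ?w + t * ip F g ?w" by (simp add: ipC)
      also have "\<dots> = 1 + 2 * t * ip F f g + t\<^sup>2 * ip F g g"
        by (simp add: ipR f1 ipC[of g f] power2_eq_square algebra_simps)
      finally show ?thesis
        using bound[OF comb[OF fC g, of t]] expand[OF fC g, of t]
        by (simp add: \<mu>_def[symmetric] algebra_simps)
    qed
    then show ?thesis using linear_term_zero by fastforce
  qed
  \<comment> \<open>The residual lies in \<open>C\<close>, so it is orthogonal to itself.\<close>
  define r where "r = (\<lambda>x. L f x + (- \<mu>) * f x)"
  have r: "r \<in> C" unfolding r_def by (rule comb[OF L[OF fC] fC])
  have "ip F r r = ip F r (L f) + (- \<mu>) * ip F r f" by (subst (2) r_def) (rule ipR)
  also have "\<dots> = 0" using crit[OF r] by (simp add: ipC)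
  finally have "r = (\<lambda>x. 0)" by (rule ip0[OF r])
  then have "L f = (\<lambda>x. \<mu> * f x)" by (auto simp: r_def fun_eq_iff)
  moreover have "f \<noteq> (\<lambda>x. 0)" using f1 by (auto simp: ip_def)
  ultimately show ?thesis using that fC bound by blast
qed

section \<open>Alternating functions on lists\<close>

text \<open>Only exchanges of neighbouring entries are demanded. This is easier to verify for the operators
  below than the rule for all permutations, which follows from it (\<open>alternating_permute\<close>).\<close>

definition alternating :: "('a list \<Rightarrow> real) \<Rightarrow> bool" where
  "alternating \<phi> \<longleftrightarrow> (\<forall>xs a b ys. \<phi> (xs @ a # b # ys) = - \<phi> (xs @ b # a # ys))"

lemma alternatingI:
  "(\<And>xs a b ys. \<phi> (xs @ a # b # ys) = - \<phi> (xs @ b # a # ys)) \<Longrightarrow> alternating \<phi>"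
  unfolding alternating_def by blast

lemma alternatingD: "alternating \<phi> \<Longrightarrow> \<phi> (xs @ a # b # ys) = - \<phi> (xs @ b # a # ys)"
  unfolding alternating_def by blast

abbreviation omit :: "nat \<Rightarrow> 'a list \<Rightarrow> 'a list" where
  "omit i vs \<equiv> take i vs @ drop (Suc i) vs"

lemma alternating_Cons:
  assumes "alternating \<phi>"
  shows "alternating (\<lambda>ws. \<phi> (v # ws))"
proof (rule alternatingI)
  show "\<phi> (v # xs @ a # b # ys) = - \<phi> (v # xs @ b # a # ys)" for xs a b ys
    using alternatingD[OF assms, of "v # xs" a b ys] by simp
qed

lemma alternating_move:
  assumes "alternating \<phi>"
  shows "\<phi> (ps @ xs @ v # ys) = (- 1) ^ length xs * \<phi> (ps @ v # xs @ ys)"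
proof (induction xs arbitrary: ps)
  case (Cons x xs)
  have "\<phi> (ps @ (x # xs) @ v # ys) = (- 1) ^ length xs * \<phi> (ps @ x # v # xs @ ys)"
    using Cons.IH[of "ps @ [x]"] by simp
  also have "\<phi> (ps @ x # v # xs @ ys) = - \<phi> (ps @ v # x # xs @ ys)"
    using alternatingD[OF assms] .
  finally show ?case by simp
qed simp

text \<open>An exchange of distant entries: move one entry past the block between them, exchange it with its
  neighbour, and move the other one back past the block; the two signs of the moves cancel.\<close>

lemma alternating_exchange:
  assumes "alternating \<phi>"
  shows "\<phi> (xs @ b # zs @ a # ys) = - \<phi> (xs @ a # zs @ b # ys)"
proof -
  have "\<phi> (xs @ b # zs @ a # ys) = (- 1) ^ length zs * \<phi> (xs @ b # a # zs @ ys)"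
    using alternating_move[OF assms, of "xs @ [b]" zs a ys] by simp
  also have "\<phi> (xs @ b # a # zs @ ys) = - \<phi> (xs @ a # b # zs @ ys)"
    using alternatingD[OF assms] .
  also have "(- 1) ^ length zs * (- \<phi> (xs @ a # b # zs @ ys)) = - \<phi> (xs @ a # zs @ b # ys)"
    using alternating_move[OF assms, of "xs @ [a]" zs b ys] by simp
  finally show ?thesis .
qed

lemma alternating_replace:
  assumes "alternating \<phi>" "i < length vs"
  shows "\<phi> (v # omit i vs) = (- 1) ^ i * \<phi> (vs[i := v])"
proof -
  have "\<phi> (vs[i := v]) = (- 1) ^ i * \<phi> (v # omit i vs)"
    using alternating_move[OF assms(1), of "[]" "take i vs" v "drop (Suc i) vs"] assms(2)
    by (simp add: upd_conv_take_nth_drop)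
  then show ?thesis by (simp add: power_add[symmetric])
qed

lemma alternating_front:
  assumes "alternating \<phi>" "i < length vs"
  shows "\<phi> (vs ! i # omit i vs) = (- 1) ^ i * \<phi> vs"
  using alternating_replace[OF assms, of "vs ! i"] by simp

lemma permute_list_transpose:
  "permute_list (Transposition.transpose (length xs) (length (xs @ a # zs))) (xs @ a # zs @ b # ys)
    = xs @ b # zs @ a # ys" (is "permute_list ?p ?vs = _")
proof (rule nth_equalityI)
  have p: "?p permutes {..<length ?vs}"
    by (intro permutes_swap_id) auto
  fix l assume "l < length (permute_list ?p ?vs)"
  then have l: "l < length ?vs" by simp
  consider "l < length xs" | "l = length xs" | "length xs < l" "l < length (xs @ a # zs)"
    | "l = length (xs @ a # zs)" | "length (xs @ a # zs) < l" by linarith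
  then show "permute_list ?p ?vs ! l = (xs @ b # zs @ a # ys) ! l"
    unfolding permute_list_nth[OF p l]
    by cases (auto simp: nth_append nth_Cons' transpose_def)
qed simp

lemma alternating_transpose:
  assumes "alternating \<phi>" "i < length vs" "j < length vs" "i \<noteq> j"
  shows "\<phi> (permute_list (Transposition.transpose i j) vs) = - \<phi> vs"
proof -
  have *: "\<phi> (permute_list (Transposition.transpose i j) vs) = - \<phi> vs"
    if ij: "i < j" "j < length vs" for i j
  proof -
    obtain xs a us where us: "vs = xs @ a # us" "length xs = i"
      by (metis ij id_take_nth_drop length_take less_trans min.absorb4)
    moreover obtain zs b ys where "us = zs @ b # ys" "length zs = j - Suc i"
    proof -
      have "j - Suc i < length us" using ij us by simp
      then show ?thesis using that by (metis id_take_nth_drop length_take min.absorb4)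
    qed
    ultimately have vs: "vs = xs @ a # zs @ b # ys" and i: "i = length xs"
      and j: "j = length (xs @ a # zs)"
      using ij by auto
    show ?thesis
      unfolding vs i j permute_list_transpose by (rule alternating_exchange[OF assms(1)])
  qed
  show ?thesis
    using *[of i j] *[of j i] assms(2-4) by (metis linorder_neqE_nat transpose_commute)
qed

lemma alternating_permute:
  assumes "alternating \<phi>" "p permutes {..<length vs}"
  shows "\<phi> (permute_list p vs) = of_int (sign p) * \<phi> vs"
proof -
  have "\<forall>us. length us = length vs \<longrightarrow> \<phi> (permute_list p us) = of_int (sign p) * \<phi> us"
    using assms(2) finite_lessThan
  proof (induction p rule: permutes_induct)
    case (swap a b p)
    show ?case
    proof (intro allI impI)
      fix us :: "'a list" assume us: "length us = length vs"
      have "permutation p" using swap by (auto simp: permutation_permutes)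
      then have "sign (Transposition.transpose a b \<circ> p) = - sign p"
        using swap by (simp add: sign_compose permutation_swap_id sign_swap_id)
      then show "\<phi> (permute_list (Transposition.transpose a b \<circ> p) us)
          = of_int (sign (Transposition.transpose a b \<circ> p)) * \<phi> us"
        using swap us by (simp add: permute_list_compose alternating_transpose[OF assms(1)])
    qed
  qed simp
  then show ?thesis by simp
qed

section \<open>Cochains, the adjoint coboundary and the Laplacian\<close>

lemma ordered_simplices_cong:
  assumes "mset vs = mset ws"
  shows "vs \<in> ordered_simplices X k \<longleftrightarrow> ws \<in> ordered_simplices X k"
  using mset_eq_setD[OF assms] mset_eq_length[OF assms] mset_eq_imp_distinct_iff[OF assms]
  by (simp add: ordered_simplices_def)

lemma cochains_iff:
  "\<phi> \<in> cochains X k \<longleftrightarrow> (\<forall>vs. vs \<notin> ordered_simplices X k \<longrightarrow> \<phi> vs = 0) \<and> alternating \<phi>"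
proof (intro iffI conjI)
  assume \<phi>: "\<phi> \<in> cochains X k"
  then show supp: "\<forall>vs. vs \<notin> ordered_simplices X k \<longrightarrow> \<phi> vs = 0"
    by (simp add: cochains_def)
  show "alternating \<phi>"
  proof (rule alternatingI)
    fix xs ys :: "'a list" and a b
    let ?vs = "xs @ b # a # ys" and ?p = "Transposition.transpose (length xs) (Suc (length xs))"
    show "\<phi> (xs @ a # b # ys) = - \<phi> ?vs"
    proof (cases "?vs \<in> ordered_simplices X k")
      case True
      have "?p permutes {..<length ?vs}" by (intro permutes_swap_id) auto
      then have "\<phi> (permute_list ?p ?vs) = of_int (sign ?p) * \<phi> ?vs"
        using \<phi> True by (simp add: cochains_def)
      then show ?thesis
        using permute_list_transpose[of xs b "[]" a ys] by (simp add: sign_swap_id)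
    next
      case False
      then have "xs @ a # b # ys \<notin> ordered_simplices X k"
        using ordered_simplices_cong[of ?vs "xs @ a # b # ys"] by simp
      then show ?thesis using supp False by simp
    qed
  qed
next
  assume "(\<forall>vs. vs \<notin> ordered_simplices X k \<longrightarrow> \<phi> vs = 0) \<and> alternating \<phi>"
  then show "\<phi> \<in> cochains X k"
    by (auto simp: cochains_def alternating_permute)
qed

lemma cochains_comb:
  assumes "\<phi> \<in> cochains X k" "\<psi> \<in> cochains X k"
  shows "(\<lambda>vs. \<phi> vs + c * \<psi> vs) \<in> cochains X k"
proof -
  have alt: "alternating \<phi>" "alternating \<psi>"
    using assms by (simp_all add: cochains_iff)
  have "alternating (\<lambda>vs. \<phi> vs + c * \<psi> vs)"
  proof (rule alternatingI)
    fix xs ys :: "'a list" and a b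
    show "\<phi> (xs @ a # b # ys) + c * \<psi> (xs @ a # b # ys)
        = - (\<phi> (xs @ b # a # ys) + c * \<psi> (xs @ b # a # ys))"
      using alternatingD[OF alt(1), of xs a b ys] alternatingD[OF alt(2), of xs a b ys] by simp
  qed
  then show ?thesis using assms by (simp add: cochains_iff)
qed

lemma closed_cochains: "closed (cochains X k)"
proof -
  have eq: "cochains X k = {\<phi>. (\<forall>vs. vs \<notin> ordered_simplices X k \<longrightarrow> \<phi> vs = 0)
      \<and> (\<forall>xs a b ys. \<phi> (xs @ a # b # ys) = - \<phi> (xs @ b # a # ys))}"
    unfolding set_eq_iff mem_Collect_eq cochains_iff alternating_def by (intro allI refl)
  show ?thesis
    unfolding eq
    by (intro closed_Collect_conj closed_Collect_all closed_Collect_imp open_Collect_const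
        closed_Collect_eq continuous_intros continuous_on_product_coordinates)
qed

text \<open>The boundary sum \<open>D\<close> obeys \<open>D \<phi> (v # vs) = \<phi> vs - D (\<lambda>ws. \<phi> (v # ws)) vs\<close>, which reduces an exchange
  anywhere in the list to one at its head without any bookkeeping of indices and signs.\<close>

lemma alternating_boundary:
  assumes "alternating \<phi>"
  shows "alternating (\<lambda>vs. \<Sum>i<length vs. (- 1) ^ i * \<phi> (omit i vs))"
proof -
  define D where "D \<phi> vs = (\<Sum>i<length vs. (- 1) ^ i * \<phi> (omit i vs))"
    for \<phi> :: "'a list \<Rightarrow> real" and vs
  have D_Cons: "D \<phi> (v # vs) = \<phi> vs - D (\<lambda>ws. \<phi> (v # ws)) vs" for \<phi> v vs
    by (simp add: D_def sum.lessThan_Suc_shift sum_negf del: sum.lessThan_Suc)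
  have "D \<phi> (xs @ a # b # ys) = - D \<phi> (xs @ b # a # ys)" for xs a b ys
    using assms
  proof (induction xs arbitrary: \<phi>)
    case Nil
    have "D (\<lambda>ws. \<phi> (a # b # ws)) ys = - D (\<lambda>ws. \<phi> (b # a # ws)) ys"
      using alternatingD[OF Nil, of "[]" a b] by (simp add: D_def sum_negf)
    then show ?case by (simp add: D_Cons)
  next
    case (Cons x xs)
    have "\<phi> (xs @ a # b # ys) = - \<phi> (xs @ b # a # ys)"
      by (rule alternatingD[OF Cons.prems])
    then show ?case
      using Cons.IH[OF alternating_Cons[OF Cons.prems, of x]] by (simp add: D_Cons)
  qed
  from alternatingI[of "D \<phi>", OF this] show ?thesis by (simp add: D_def[abs_def])
qed

lemma coboundary_in_cochains:
  assumes "\<phi> \<in> cochains X k"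
  shows "coboundary X k \<phi> \<in> cochains X (k + 1)"
proof -
  have alt: "alternating (\<lambda>vs. \<Sum>i<length vs. (- 1) ^ i * \<phi> (omit i vs))"
    using assms by (simp add: alternating_boundary cochains_iff)
  have "coboundary X k \<phi> (xs @ a # b # ys) = - coboundary X k \<phi> (xs @ b # a # ys)" for xs a b ys
    using alternatingD[OF alt, of xs a b ys]
      ordered_simplices_cong[of "xs @ a # b # ys" "xs @ b # a # ys" X "k + 1"]
    by (simp add: coboundary_def)
  from alternatingI[of "coboundary X k \<phi>", OF this] show ?thesis
    by (simp add: cochains_iff coboundary_def)
qed

lemma mset_front: "i < length vs \<Longrightarrow> mset (vs ! i # omit i vs) = mset vs"
  by (metis id_take_nth_drop mset.simps(2) mset_append union_mset_add_mset_right)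

text \<open>Moving the entry at position \<open>i\<close> to the front permutes the ordered simplices. With the sign of this
  move, it makes all positions of an ordered simplex play the same role in a sum over all of them.\<close>

lemma sum_front:
  assumes "int i < k + 1"
  shows "(\<Sum>vs\<in>ordered_simplices X k. g (vs ! i # omit i vs)) = (\<Sum>vs\<in>ordered_simplices X k. g vs)"
proof (rule sum.reindex_bij_witness[where j = "\<lambda>vs. vs ! i # omit i vs"
      and i = "\<lambda>ws. take i (tl ws) @ hd ws # drop i (tl ws)"])
  fix vs assume vs: "vs \<in> ordered_simplices X k"
  then have i: "i < length vs" using assms by (simp add: ordered_simplices_def)
  show "take i (tl (vs ! i # omit i vs)) @ hd (vs ! i # omit i vs)
      # drop i (tl (vs ! i # omit i vs)) = vs"
    using i by (simp add: min_def id_take_nth_drop[symmetric])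
  show "vs ! i # omit i vs \<in> ordered_simplices X k"
    using vs ordered_simplices_cong[OF mset_front[OF i]] by blast
next
  fix ws assume ws: "ws \<in> ordered_simplices X k"
  then obtain w us where w: "ws = w # us" and i: "i \<le> length us"
    using assms by (cases ws) (auto simp: ordered_simplices_def)
  show "(take i (tl ws) @ hd ws # drop i (tl ws)) ! i # omit i (take i (tl ws) @ hd ws # drop i (tl ws)) = ws"
    using i by (simp add: w nth_append)
  have "mset (take i (tl ws) @ hd ws # drop i (tl ws)) = mset ws"
    by (simp add: w) (metis append_take_drop_id mset_append)
  then show "take i (tl ws) @ hd ws # drop i (tl ws) \<in> ordered_simplices X k"
    using ws ordered_simplices_cong by blast
qed simp

locale finite_complex =
  fixes X :: "'a set set" and V :: "'a set"
  assumes finite_vertices: "finite V"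
    and simplex_subset: "\<sigma> \<in> X \<Longrightarrow> \<sigma> \<subseteq> V"
    and face: "\<sigma> \<in> X \<Longrightarrow> \<tau> \<subseteq> \<sigma> \<Longrightarrow> \<tau> \<in> X"
begin

definition ordered_inner :: "int \<Rightarrow> ('a list \<Rightarrow> real) \<Rightarrow> ('a list \<Rightarrow> real) \<Rightarrow> real" where
  "ordered_inner k \<phi> \<psi> = (\<Sum>vs\<in>ordered_simplices X k. \<phi> vs * \<psi> vs)"

definition codifferential :: "('a list \<Rightarrow> real) \<Rightarrow> 'a list \<Rightarrow> real" where
  "codifferential \<psi> ws = (\<Sum>v\<in>V. \<psi> (v # ws))"

lemma finite_ordered_simplices: "finite (ordered_simplices X k)"
proof (rule finite_subset)
  show "ordered_simplices X k \<subseteq> {vs. set vs \<subseteq> V \<and> length vs = nat (k + 1)}"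
    using simplex_subset by (auto simp: ordered_simplices_def)
qed (rule finite_lists_length_eq[OF finite_vertices])

lemma ordered_simplices_tl:
  assumes "v # ws \<in> ordered_simplices X (k + 1)"
  shows "v \<in> V" "ws \<in> ordered_simplices X k"
  using assms simplex_subset face[of "insert v (set ws)" "set ws"] by (auto simp: ordered_simplices_def)

lemma sum_Cons:
  assumes "k \<ge> -1" and "\<And>vs. vs \<notin> ordered_simplices X (k + 1) \<Longrightarrow> g vs = (0::real)"
  shows "(\<Sum>vs\<in>ordered_simplices X (k + 1). g vs)
    = (\<Sum>v\<in>V. \<Sum>ws\<in>ordered_simplices X k. g (v # ws))"
proof -
  let ?P = "V \<times> ordered_simplices X k"
  have "ordered_simplices X (k + 1) \<subseteq> (\<lambda>(v, ws). v # ws) ` ?P"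
  proof
    fix vs assume vs: "vs \<in> ordered_simplices X (k + 1)"
    then obtain v ws where "vs = v # ws"
      using assms(1) by (cases vs) (auto simp: ordered_simplices_def)
    then show "vs \<in> (\<lambda>(v, ws). v # ws) ` ?P"
      using ordered_simplices_tl vs by auto
  qed
  then have "(\<Sum>vs\<in>ordered_simplices X (k + 1). g vs) = sum g ((\<lambda>(v, ws). v # ws) ` ?P)"
    using assms(2) finite_vertices finite_ordered_simplices by (intro sum.mono_neutral_left) auto
  also have "\<dots> = (\<Sum>(v, ws)\<in>?P. g (v # ws))"
    by (subst sum.reindex) (auto simp: inj_on_def case_prod_unfold)
  finally show ?thesis by (simp add: sum.cartesian_product)
qed

text \<open>A product of two cochains does not depend on the orientation, and each \<open>k\<close>-simplex has
  \<open>(k + 1)!\<close> orderings.\<close>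

lemma cochain_inner_eq:
  assumes "\<phi> \<in> cochains X k" "\<psi> \<in> cochains X k"
  shows "fact (nat (k + 1)) * cochain_inner X k \<phi> \<psi> = ordered_inner k \<phi> \<psi>"
proof -
  have fin: "finite (simplices X k)"
    by (rule finite_subset[of _ "Pow V"])
      (use finite_vertices simplex_subset in \<open>auto simp: simplices_def\<close>)
  have "ordered_inner k \<phi> \<psi>
      = (\<Sum>\<sigma>\<in>simplices X k. \<Sum>vs\<in>{vs\<in>ordered_simplices X k. set vs = \<sigma>}. \<phi> vs * \<psi> vs)"
    unfolding ordered_inner_def
    by (rule sum.group[symmetric])
      (use fin finite_ordered_simplices in
        \<open>auto simp: ordered_simplices_def simplices_def distinct_card\<close>)
  also have "\<dots> = (\<Sum>\<sigma>\<in>simplices X k.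
      fact (nat (k + 1)) * (\<phi> (orientation \<sigma>) * \<psi> (orientation \<sigma>)))"
  proof (rule sum.cong[OF refl])
    fix \<sigma> assume \<sigma>: "\<sigma> \<in> simplices X k"
    then have "finite \<sigma>" and card: "card \<sigma> = nat (k + 1)" by (auto simp: simplices_def)
    let ?o = "orientation \<sigma>"
    have o: "distinct ?o \<and> set ?o = \<sigma>"
      unfolding orientation_def
      by (rule someI_ex) (use finite_distinct_list[OF \<open>finite \<sigma>\<close>] in blast)
    have *: "{vs\<in>ordered_simplices X k. set vs = \<sigma>} = permutations_of_set \<sigma>"
      using \<sigma> by (auto simp: ordered_simplices_def simplices_def permutations_of_set_def distinct_card)
    have "\<phi> vs * \<psi> vs = \<phi> ?o * \<psi> ?o" if vs: "vs \<in> permutations_of_set \<sigma>" for vs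
    proof -
      have "mset vs = mset ?o"
        using o permutations_of_setD[OF vs] set_eq_iff_mset_eq_distinct by metis
      then obtain p where "p permutes {..<length ?o}" "permute_list p ?o = vs"
        by (rule mset_eq_permutation)
      then have "\<phi> vs = of_int (sign p) * \<phi> ?o" "\<psi> vs = of_int (sign p) * \<psi> ?o"
        using assms alternating_permute by (auto simp: cochains_iff)
      moreover have "of_int (sign p) * of_int (sign p) = (1::real)"
        by (metis of_int_1 of_int_mult sign_idempotent)
      ultimately show ?thesis by simp
    qed
    then show "(\<Sum>vs\<in>{vs\<in>ordered_simplices X k. set vs = \<sigma>}. \<phi> vs * \<psi> vs)
        = fact (nat (k + 1)) * (\<phi> ?o * \<psi> ?o)"
      unfolding * by (simp add: card \<open>finite \<sigma>\<close>)
  qed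
  finally show ?thesis by (simp add: cochain_inner_def sum_distrib_left)
qed

lemma ordered_inner_zero:
  assumes "\<phi> \<in> cochains X k" "ordered_inner k \<phi> \<phi> = 0"
  shows "\<phi> vs = 0"
proof (cases "vs \<in> ordered_simplices X k")
  case True
  then show ?thesis
    using assms(2) finite_ordered_simplices by (simp add: ordered_inner_def sum_nonneg_eq_0_iff)
qed (use assms(1) in \<open>simp add: cochains_iff\<close>)

lemma codifferential_in_cochains:
  assumes "\<psi> \<in> cochains X (k + 1)"
  shows "codifferential \<psi> \<in> cochains X k"
proof -
  have "codifferential \<psi> ws = 0" if "ws \<notin> ordered_simplices X k" for ws
    using assms that ordered_simplices_tl(2) unfolding codifferential_def cochains_iff
    by (intro sum.neutral ballI) blast
  moreover have "alternating (codifferential \<psi>)"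
  proof (rule alternatingI)
    fix xs ys :: "'a list" and a b
    have "\<psi> (v # xs @ a # b # ys) = - \<psi> (v # xs @ b # a # ys)" for v
      using assms alternatingD[of \<psi> "v # xs" a b ys] by (simp add: cochains_iff)
    then show "codifferential \<psi> (xs @ a # b # ys) = - codifferential \<psi> (xs @ b # a # ys)"
      by (simp add: codifferential_def sum_negf)
  qed
  ultimately show ?thesis by (simp add: cochains_iff)
qed

text \<open>By \<open>sum_front\<close> each of the \<open>k + 2\<close> terms of the coboundary contributes as much as the first
  one, which omits the head of the list. The factor \<open>k + 2\<close> is the quotient of the two factorials
  that relate ordered and oriented inner products.\<close>

lemma coboundary_codifferential_adjoint:
  assumes "k \<ge> -1" and \<phi>: "\<phi> \<in> cochains X k" and \<psi>: "\<psi> \<in> cochains X (k + 1)"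
  shows "ordered_inner (k + 1) (coboundary X k \<phi>) \<psi>
    = of_int (k + 2) * ordered_inner k \<phi> (codifferential \<psi>)"
proof -
  let ?S = "ordered_simplices X (k + 1)"
  define g where "g vs = \<phi> (tl vs) * \<psi> vs" for vs
  have alt: "alternating \<psi>" using \<psi> by (simp add: cochains_iff)
  have len: "length vs = nat (k + 2)" if "vs \<in> ?S" for vs
    using that by (auto simp: ordered_simplices_def)
  have "ordered_inner (k + 1) (coboundary X k \<phi>) \<psi>
      = (\<Sum>vs\<in>?S. \<Sum>i<nat (k + 2). (- 1) ^ i * \<phi> (omit i vs) * \<psi> vs)"
    unfolding ordered_inner_def
    by (rule sum.cong) (auto simp: coboundary_def len sum_distrib_right)
  also have "\<dots> = (\<Sum>i<nat (k + 2). \<Sum>vs\<in>?S. (- 1) ^ i * \<phi> (omit i vs) * \<psi> vs)"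
    by (rule sum.swap)
  also have "\<dots> = (\<Sum>i<nat (k + 2). \<Sum>vs\<in>?S. g (vs ! i # omit i vs))"
    by (intro sum.cong refl) (simp add: g_def alternating_front[OF alt] len)
  also have "\<dots> = (\<Sum>i<nat (k + 2). \<Sum>vs\<in>?S. g vs)"
    by (intro sum.cong refl sum_front) auto
  also have "\<dots> = of_int (k + 2) * (\<Sum>vs\<in>?S. g vs)"
    using assms(1) by simp
  also have "(\<Sum>vs\<in>?S. g vs) = (\<Sum>v\<in>V. \<Sum>ws\<in>ordered_simplices X k. g (v # ws))"
    using \<psi> by (intro sum_Cons[OF assms(1)]) (simp add: g_def cochains_iff)
  also have "\<dots> = ordered_inner k \<phi> (codifferential \<psi>)"
    by (subst sum.swap) (simp add: ordered_inner_def codifferential_def g_def sum_distrib_left)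
  finally show ?thesis .
qed

lemma coboundary_adjoint_eq:
  assumes "k \<ge> -1" and \<psi>: "\<psi> \<in> cochains X (k + 1)"
  shows "coboundary_adjoint X k \<psi> = codifferential \<psi>"
  unfolding coboundary_adjoint_def
proof (rule the_equality)
  have fact: "fact (nat (k + 2)) = of_int (k + 2) * (fact (nat (k + 1)) :: real)"
    using assms(1) fact_Suc[of "nat (k + 1)", where 'a = real]
    by (simp add: Suc_nat_eq_nat_zadd1 algebra_simps)
  have adj: "cochain_inner X (k + 1) (coboundary X k \<phi>) \<psi> = cochain_inner X k \<phi> (codifferential \<psi>)"
    if \<phi>: "\<phi> \<in> cochains X k" for \<phi>
  proof -
    have "fact (nat (k + 2)) * cochain_inner X (k + 1) (coboundary X k \<phi>) \<psi>
        = fact (nat (k + 2)) * cochain_inner X k \<phi> (codifferential \<psi>)"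
      using coboundary_codifferential_adjoint[OF assms(1) \<phi> \<psi>]
        cochain_inner_eq[OF coboundary_in_cochains[OF \<phi>] \<psi>]
        cochain_inner_eq[OF \<phi> codifferential_in_cochains[OF \<psi>]]
      by (simp add: fact algebra_simps)
    then show ?thesis by simp
  qed
  show "codifferential \<psi> \<in> cochains X k \<and> (\<forall>\<phi>\<in>cochains X k.
      cochain_inner X (k + 1) (coboundary X k \<phi>) \<psi> = cochain_inner X k \<phi> (codifferential \<psi>))"
    using adj codifferential_in_cochains[OF \<psi>] by blast
  fix \<chi>
  assume \<chi>: "\<chi> \<in> cochains X k \<and> (\<forall>\<phi>\<in>cochains X k.
      cochain_inner X (k + 1) (coboundary X k \<phi>) \<psi> = cochain_inner X k \<phi> \<chi>)"
  let ?d = "\<lambda>vs. \<chi> vs + (- 1) * codifferential \<psi> vs"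
  have d: "?d \<in> cochains X k"
    using \<chi> codifferential_in_cochains[OF \<psi>] by (intro cochains_comb) auto
  have "cochain_inner X k ?d ?d = cochain_inner X k ?d \<chi> - cochain_inner X k ?d (codifferential \<psi>)"
    by (simp add: cochain_inner_def right_diff_distrib flip: sum_subtractf)
  also have "\<dots> = 0" using \<chi> adj d by (metis diff_self)
  finally have "ordered_inner k ?d ?d = 0" using cochain_inner_eq[OF d d] by simp
  then have "?d vs = 0" for vs using ordered_inner_zero[OF d] by blast
  then show "\<chi> = codifferential \<psi>" by (auto simp: fun_eq_iff)
qed

lemma laplacian_eq:
  assumes "k \<ge> 0" "\<phi> \<in> cochains X k"
  shows "laplacian X k \<phi> = (\<lambda>vs. coboundary X (k - 1) (codifferential \<phi>) vs
      + codifferential (coboundary X k \<phi>) vs)"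
  using coboundary_adjoint_eq[of "k - 1" \<phi>] coboundary_adjoint_eq[of k "coboundary X k \<phi>"]
    assms coboundary_in_cochains[OF assms(2)]
  by (simp add: laplacian_def)

lemma laplacian_in_cochains:
  assumes "k \<ge> 0" "\<phi> \<in> cochains X k"
  shows "laplacian X k \<phi> \<in> cochains X k"
proof -
  have "codifferential \<phi> \<in> cochains X (k - 1)"
    using codifferential_in_cochains[of \<phi> "k - 1"] assms(2) by simp
  then have "coboundary X (k - 1) (codifferential \<phi>) \<in> cochains X k"
    using coboundary_in_cochains[of _ X "k - 1"] by simp
  moreover have "codifferential (coboundary X k \<phi>) \<in> cochains X k"
    by (intro codifferential_in_cochains coboundary_in_cochains assms)
  ultimately show ?thesis
    using cochains_comb[of _ X k _ 1] by (simp add: laplacian_eq[OF assms])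
qed

text \<open>The two summands are multiples of \<open>(d\<^sup>* \<phi>, d\<^sup>* \<psi>)\<close> and \<open>(d \<phi>, d \<psi>)\<close>, by adjointness; the
  symmetry of the Laplacian is read off from this form.\<close>

lemma laplacian_energy:
  assumes k: "k \<ge> 0" and \<phi>: "\<phi> \<in> cochains X k" and \<psi>: "\<psi> \<in> cochains X k"
  shows "ordered_inner k (laplacian X k \<phi>) \<psi>
    = of_int (k + 1) * ordered_inner (k - 1) (codifferential \<phi>) (codifferential \<psi>)
      + ordered_inner (k + 1) (coboundary X k \<phi>) (coboundary X k \<psi>) / of_int (k + 2)"
proof -
  have c\<phi>: "codifferential \<phi> \<in> cochains X (k - 1)"
    using codifferential_in_cochains[of \<phi> "k - 1"] \<phi> by simp
  have "ordered_inner k (laplacian X k \<phi>) \<psi>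
      = ordered_inner k (coboundary X (k - 1) (codifferential \<phi>)) \<psi>
        + ordered_inner k \<psi> (codifferential (coboundary X k \<phi>))"
    by (simp add: laplacian_eq[OF k \<phi>] ordered_inner_def sum.distrib algebra_simps)
  also have "ordered_inner k (coboundary X (k - 1) (codifferential \<phi>)) \<psi>
      = of_int (k + 1) * ordered_inner (k - 1) (codifferential \<phi>) (codifferential \<psi>)"
    using coboundary_codifferential_adjoint[of "k - 1", OF _ c\<phi>] k \<psi> by (simp add: add.commute)
  also have "ordered_inner k \<psi> (codifferential (coboundary X k \<phi>))
      = ordered_inner (k + 1) (coboundary X k \<psi>) (coboundary X k \<phi>) / of_int (k + 2)"
    using coboundary_codifferential_adjoint[OF _ \<psi> coboundary_in_cochains[OF \<phi>]] k by simp
  finally show ?thesis by (simp add: ordered_inner_def mult.commute)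
qed

lemma ordered_inner_commute: "ordered_inner k \<phi> \<psi> = ordered_inner k \<psi> \<phi>"
  by (simp add: ordered_inner_def mult.commute)

lemma laplacian_symmetric:
  assumes "k \<ge> 0" "\<phi> \<in> cochains X k" "\<psi> \<in> cochains X k"
  shows "ordered_inner k (laplacian X k \<phi>) \<psi> = ordered_inner k \<phi> (laplacian X k \<psi>)"
  unfolding ordered_inner_commute[of k \<phi>]
  using laplacian_energy[OF assms] laplacian_energy[OF assms(1,3,2)] by (simp add: ordered_inner_commute)

text \<open>The sum over \<open>v\<close> and \<open>i\<close> of \<open>\<phi> (vs[i := v])\<close> is \<open>d d\<^sup>* \<phi>\<close>. In \<open>d\<^sup>* d \<phi>\<close>, only those \<open>v\<close> for which
  \<open>v # vs\<close> is a simplex occur; for these, omitting \<open>v\<close> gives \<open>\<phi> vs\<close> and omitting another entry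
  gives \<open>\<phi> (vs[i := v])\<close> with the opposite sign, which cancels.\<close>

lemma laplacian_pointwise:
  assumes k: "k \<ge> 0" and \<phi>: "\<phi> \<in> cochains X k" and vs: "vs \<in> ordered_simplices X k"
  shows "laplacian X k \<phi> vs = (\<Sum>v\<in>V. if v # vs \<in> ordered_simplices X (k + 1) then \<phi> vs
      else \<Sum>i<length vs. \<phi> (vs[i := v]))"
proof -
  have alt: "alternating \<phi>" using \<phi> by (simp add: cochains_iff)
  have repl: "(- 1) ^ i * \<phi> (v # omit i vs) = \<phi> (vs[i := v])" if "i < length vs" for i v
    by (simp add: alternating_replace[OF alt that] flip: mult.assoc power_add)
  have "coboundary X (k - 1) (codifferential \<phi>) vs
      = (\<Sum>i<length vs. \<Sum>v\<in>V. (- 1) ^ i * \<phi> (v # omit i vs))"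
    using vs by (simp add: coboundary_def codifferential_def sum_distrib_left)
  also have "\<dots> = (\<Sum>v\<in>V. \<Sum>i<length vs. \<phi> (vs[i := v]))"
    by (subst sum.swap) (simp add: repl)
  finally have 1: "coboundary X (k - 1) (codifferential \<phi>) vs
      = (\<Sum>v\<in>V. \<Sum>i<length vs. \<phi> (vs[i := v]))" .
  have "coboundary X k \<phi> (v # vs) = (if v # vs \<in> ordered_simplices X (k + 1)
      then \<phi> vs - (\<Sum>i<length vs. \<phi> (vs[i := v])) else 0)" for v
    by (simp add: coboundary_def sum.lessThan_Suc_shift sum_negf repl del: sum.lessThan_Suc)
  then have 2: "codifferential (coboundary X k \<phi>) vs
      = (\<Sum>v\<in>V. if v # vs \<in> ordered_simplices X (k + 1)
          then \<phi> vs - (\<Sum>i<length vs. \<phi> (vs[i := v])) else 0)"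
    by (simp add: codifferential_def)
  show ?thesis
    unfolding laplacian_eq[OF k \<phi>] 1 2 sum.distrib[symmetric] by (intro sum.cong) auto
qed

lemma continuous_on_laplacian:
  assumes "k \<ge> 0"
  shows "continuous_on (cochains X k) (\<lambda>\<phi>. laplacian X k \<phi> vs)"
proof -
  have coord: "continuous_on (cochains X k) (\<lambda>\<phi>. \<phi> us)" for us
    by (rule continuous_on_subset[OF continuous_on_product_coordinates]) simp
  show ?thesis
  proof (cases "vs \<in> ordered_simplices X k")
    case True
    have "continuous_on (cochains X k) (\<lambda>\<phi>. \<Sum>v\<in>V. if v # vs \<in> ordered_simplices X (k + 1)
        then \<phi> vs else \<Sum>i<length vs. \<phi> (vs[i := v]))"
    proof (rule continuous_on_sum)
      show "continuous_on (cochains X k) (\<lambda>\<phi>. if v # vs \<in> ordered_simplices X (k + 1)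
          then \<phi> vs else \<Sum>i<length vs. \<phi> (vs[i := v]))" for v
        by (cases "v # vs \<in> ordered_simplices X (k + 1)") (simp_all add: continuous_on_sum coord)
    qed
    then show ?thesis
      using laplacian_pointwise[OF assms _ True] by (simp cong: continuous_on_cong)
  next
    case False
    then have "laplacian X k \<phi> vs = 0" if "\<phi> \<in> cochains X k" for \<phi>
      using laplacian_in_cochains[OF assms that] by (simp add: cochains_iff)
    then show ?thesis by (simp cong: continuous_on_cong)
  qed
qed

lemma finite_laplacian_eigenvalues:
  assumes k: "k \<ge> 0"
  shows "finite (laplacian_eigenvalues X k)"
proof -
  let ?E = "laplacian_eigenvalues X k"
  define f where "f \<mu> = (SOME \<phi>. \<phi> \<in> cochains X k \<and> \<phi> \<noteq> (\<lambda>vs. 0)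
      \<and> laplacian X k \<phi> = (\<lambda>vs. \<mu> * \<phi> vs))" for \<mu>
  have f: "f \<mu> \<in> cochains X k" "f \<mu> \<noteq> (\<lambda>vs. 0)" "laplacian X k (f \<mu>) = (\<lambda>vs. \<mu> * f \<mu> vs)"
    if "\<mu> \<in> ?E" for \<mu>
  proof -
    have "\<exists>\<phi>. \<phi> \<in> cochains X k \<and> \<phi> \<noteq> (\<lambda>vs. 0) \<and> laplacian X k \<phi> = (\<lambda>vs. \<mu> * \<phi> vs)"
      using that by (auto simp: laplacian_eigenvalues_def)
    from someI_ex[OF this] show "f \<mu> \<in> cochains X k" "f \<mu> \<noteq> (\<lambda>vs. 0)"
      "laplacian X k (f \<mu>) = (\<lambda>vs. \<mu> * f \<mu> vs)"
      unfolding f_def by blast+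
  qed
  show ?thesis
  proof (rule finite_eigenvalues[OF finite_ordered_simplices])
    fix e assume e: "e \<in> ?E"
    have "ordered_inner k (f e) (f e) \<noteq> 0"
      using ordered_inner_zero[OF f(1)[OF e]] f(2)[OF e] by blast
    moreover have "ordered_inner k (f e) (f e) \<ge> 0" by (simp add: ordered_inner_def sum_nonneg)
    ultimately show "(\<Sum>vs\<in>ordered_simplices X k. (f e vs)\<^sup>2) > 0"
      by (simp add: ordered_inner_def power2_eq_square)
  next
    fix d e assume de: "d \<in> ?E" "e \<in> ?E" "d \<noteq> e"
    have "d * ordered_inner k (f d) (f e) = ordered_inner k (laplacian X k (f d)) (f e)"
      by (simp add: f de ordered_inner_def sum_distrib_left mult.assoc)
    also have "\<dots> = ordered_inner k (f d) (laplacian X k (f e))"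
      by (rule laplacian_symmetric) (use k f de in auto)
    also have "\<dots> = e * ordered_inner k (f d) (f e)"
      by (simp add: f de ordered_inner_def sum_distrib_left algebra_simps)
    finally show "(\<Sum>vs\<in>ordered_simplices X k. f d vs * f e vs) = 0"
      using de(3) by (simp add: ordered_inner_def)
  qed
qed

text \<open>The nonzero cochain \<open>h\<close> is there because without \<open>k\<close>-simplices there are no eigenvalues.\<close>

lemma rayleigh_laplacian:
  assumes k: "k \<ge> 0" and h: "h \<in> cochains X k" "h \<noteq> (\<lambda>vs. 0)"
  shows "laplacian_eigenvalues X k \<noteq> {}"
    and "\<phi> \<in> cochains X k \<Longrightarrow>
      Min (laplacian_eigenvalues X k) * ordered_inner k \<phi> \<phi> \<le> ordered_inner k \<phi> (laplacian X k \<phi>)"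
proof -
  obtain \<mu> f where f: "f \<in> cochains X k" "f \<noteq> (\<lambda>vs. 0)" "laplacian X k f = (\<lambda>vs. \<mu> * f vs)"
    and bound: "\<And>g. g \<in> cochains X k \<Longrightarrow>
      \<mu> * ordered_inner k g g \<le> ordered_inner k g (laplacian X k g)"
  proof (rule rayleigh_minimum[of "ordered_simplices X k" "cochains X k" "laplacian X k" h])
    show "(\<Sum>vs\<in>ordered_simplices X k. laplacian X k f vs * g vs)
        = (\<Sum>vs\<in>ordered_simplices X k. f vs * laplacian X k g vs)"
      if "f \<in> cochains X k" "g \<in> cochains X k" for f g
      using laplacian_symmetric[OF k that] by (simp add: ordered_inner_def)
  qed (use h k in \<open>auto simp: finite_ordered_simplices closed_cochains cochains_comb
      laplacian_in_cochains continuous_on_laplacian cochains_iff[THEN iffD1] ordered_inner_def\<close>)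
  then have \<mu>: "\<mu> \<in> laplacian_eigenvalues X k" by (auto simp: laplacian_eigenvalues_def)
  then show "laplacian_eigenvalues X k \<noteq> {}" by blast
  assume \<phi>: "\<phi> \<in> cochains X k"
  have "Min (laplacian_eigenvalues X k) \<le> \<mu>"
    using \<mu> finite_laplacian_eigenvalues[OF k] by simp
  then have "Min (laplacian_eigenvalues X k) * ordered_inner k \<phi> \<phi> \<le> \<mu> * ordered_inner k \<phi> \<phi>"
    by (rule mult_right_mono) (simp add: ordered_inner_def sum_nonneg)
  also have "\<dots> \<le> ordered_inner k \<phi> (laplacian X k \<phi>)" by (rule bound[OF \<phi>])
  finally show "Min (laplacian_eigenvalues X k) * ordered_inner k \<phi> \<phi>
    \<le> ordered_inner k \<phi> (laplacian X k \<phi>)" .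
qed

end

section \<open>Links of vertices and flag complexes\<close>

context finite_complex
begin

lemma restrict_in_cochains:
  assumes "\<phi> \<in> cochains X (k + 1)"
  shows "(\<lambda>ws. \<phi> (v # ws)) \<in> cochains X k"
  using assms ordered_simplices_tl(2)[of v _ k] alternating_Cons by (auto simp: cochains_iff)

text \<open>The ordered simplices starting with \<open>u\<close>, for all \<open>u\<close>, are all the ordered simplices. In ordered
  sums the factor \<open>k + 2\<close> that oriented simplices would need does not appear.\<close>

lemma ordered_inner_restrict:
  assumes "k \<ge> -1" "\<phi> \<in> cochains X (k + 1)"
  shows "(\<Sum>u\<in>V. ordered_inner k (\<lambda>ws. \<phi> (u # ws)) (\<lambda>ws. \<phi> (u # ws)))
    = ordered_inner (k + 1) \<phi> \<phi>"
  unfolding ordered_inner_def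
  using sum_Cons[OF assms(1), of "\<lambda>vs. \<phi> vs * \<phi> vs"] assms(2) by (simp add: cochains_iff)

lemma sum_rotate:
  fixes f :: "'b \<Rightarrow> 'c \<Rightarrow> 'd \<Rightarrow> 'e::comm_monoid_add"
  shows "(\<Sum>x\<in>A. \<Sum>y\<in>B. \<Sum>z\<in>C. f x y z) = (\<Sum>z\<in>C. \<Sum>x\<in>A. \<Sum>y\<in>B. f x y z)"
proof -
  have "(\<Sum>y\<in>B. \<Sum>z\<in>C. f x y z) = (\<Sum>z\<in>C. \<Sum>y\<in>B. f x y z)" for x
    by (rule sum.swap)
  then show ?thesis by (simp only:) (rule sum.swap)
qed

text \<open>The exchange part of the energy at position \<open>i\<close>. The entries of \<open>vs\<close> itself are among the \<open>v\<close> for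
  which \<open>v # vs\<close> is not a simplex.\<close>

definition exchange_sum :: "int \<Rightarrow> ('a list \<Rightarrow> real) \<Rightarrow> nat \<Rightarrow> real" where
  "exchange_sum k \<phi> i = (\<Sum>vs\<in>ordered_simplices X k. \<Sum>v\<in>V.
     if v # vs \<in> ordered_simplices X (k + 1) then 0 else \<phi> vs * \<phi> (vs[i := v]))"

text \<open>The sum of \<open>(\<phi> vs)\<^sup>2\<close> weighted with the degree of the facet that lacks the entry at position \<open>i\<close>;
  the omitted vertex counts in this degree.\<close>

definition degree_sum :: "int \<Rightarrow> ('a list \<Rightarrow> real) \<Rightarrow> nat \<Rightarrow> real" where
  "degree_sum k \<phi> i = (\<Sum>vs\<in>ordered_simplices X k. \<Sum>v\<in>V.
     if v # omit i vs \<in> ordered_simplices X k then (\<phi> vs)\<^sup>2 else 0)"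

lemma ordered_simplices_Cons_front:
  assumes "i < length vs"
  shows "v # vs ! i # omit i vs \<in> ordered_simplices X k \<longleftrightarrow> v # vs \<in> ordered_simplices X k"
  by (rule ordered_simplices_cong) (use mset_front[OF assms] in simp)

text \<open>When the entry at position \<open>i\<close> is moved to the front, both \<open>\<phi> vs\<close> and \<open>\<phi> (vs[i := v])\<close> acquire
  the sign \<open>(- 1) ^ i\<close>, so their product does not change.\<close>

lemma exchange_sum_const:
  assumes \<phi>: "\<phi> \<in> cochains X k" and i: "int i < k + 1"
  shows "exchange_sum k \<phi> i = exchange_sum k \<phi> 0"
proof -
  define g where "g vs = (\<Sum>v\<in>V. if v # vs \<in> ordered_simplices X (k + 1) then 0
      else \<phi> vs * \<phi> (vs[0 := v]))" for vs
  have alt: "alternating \<phi>" using \<phi> by (simp add: cochains_iff)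
  have "g (vs ! i # omit i vs) = (\<Sum>v\<in>V. if v # vs \<in> ordered_simplices X (k + 1) then 0
      else \<phi> vs * \<phi> (vs[i := v]))" if vs: "vs \<in> ordered_simplices X k" for vs
  proof -
    have il: "i < length vs" using i vs by (simp add: ordered_simplices_def)
    have "\<phi> (vs ! i # omit i vs) * \<phi> (v # omit i vs) = \<phi> vs * \<phi> (vs[i := v])" for v
      unfolding alternating_front[OF alt il] alternating_replace[OF alt il]
      by (simp add: power_mult_distrib[symmetric] flip: power_add)
    then show ?thesis
      by (simp only: g_def list_update_code ordered_simplices_Cons_front[OF il])
  qed
  then have "exchange_sum k \<phi> i = (\<Sum>vs\<in>ordered_simplices X k. g (vs ! i # omit i vs))"
    by (simp add: exchange_sum_def)
  also have "\<dots> = (\<Sum>vs\<in>ordered_simplices X k. g vs)" by (rule sum_front[OF i])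
  finally show ?thesis by (simp add: exchange_sum_def g_def)
qed

lemma degree_sum_const:
  assumes \<phi>: "\<phi> \<in> cochains X k" and i: "int i < k + 1"
  shows "degree_sum k \<phi> i = degree_sum k \<phi> 0"
proof -
  define g where "g vs = (\<Sum>v\<in>V. if v # omit 0 vs \<in> ordered_simplices X k then (\<phi> vs)\<^sup>2 else 0)" for vs
  have alt: "alternating \<phi>" using \<phi> by (simp add: cochains_iff)
  have "g (vs ! i # omit i vs)
      = (\<Sum>v\<in>V. if v # omit i vs \<in> ordered_simplices X k then (\<phi> vs)\<^sup>2 else 0)"
    if vs: "vs \<in> ordered_simplices X k" for vs
  proof -
    have il: "i < length vs" using i vs by (simp add: ordered_simplices_def)
    have sq: "(\<phi> (vs ! i # omit i vs))\<^sup>2 = (\<phi> vs)\<^sup>2"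
      unfolding alternating_front[OF alt il] by (simp add: power_mult_distrib flip: power_mult)
    show ?thesis unfolding g_def sq by simp
  qed
  then have "degree_sum k \<phi> i = (\<Sum>vs\<in>ordered_simplices X k. g (vs ! i # omit i vs))"
    by (simp add: degree_sum_def)
  also have "\<dots> = (\<Sum>vs\<in>ordered_simplices X k. g vs)" by (rule sum_front[OF i])
  finally show ?thesis by (simp add: degree_sum_def g_def)
qed

lemma laplacian_form:
  assumes k: "k \<ge> 0" and \<phi>: "\<phi> \<in> cochains X k"
  shows "ordered_inner k \<phi> (laplacian X k \<phi>)
    = (\<Sum>vs\<in>ordered_simplices X k. \<Sum>v\<in>V.
         if v # vs \<in> ordered_simplices X (k + 1) then (\<phi> vs)\<^sup>2 else 0)
      + of_int (k + 1) * exchange_sum k \<phi> 0"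
proof -
  have len: "length vs = nat (k + 1)" if "vs \<in> ordered_simplices X k" for vs
    using that by (auto simp: ordered_simplices_def)
  have "ordered_inner k \<phi> (laplacian X k \<phi>)
      = (\<Sum>vs\<in>ordered_simplices X k. \<Sum>v\<in>V.
          (if v # vs \<in> ordered_simplices X (k + 1) then (\<phi> vs)\<^sup>2 else 0)
          + (\<Sum>i<nat (k + 1). if v # vs \<in> ordered_simplices X (k + 1) then 0
               else \<phi> vs * \<phi> (vs[i := v])))"
    unfolding ordered_inner_def
    by (intro sum.cong refl)
      (auto simp: laplacian_pointwise[OF k \<phi>] len sum_distrib_left power2_eq_square intro!: sum.cong)
  also have "\<dots> = (\<Sum>vs\<in>ordered_simplices X k. \<Sum>v\<in>V.
         if v # vs \<in> ordered_simplices X (k + 1) then (\<phi> vs)\<^sup>2 else 0)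
      + (\<Sum>vs\<in>ordered_simplices X k. \<Sum>v\<in>V. \<Sum>i<nat (k + 1).
          if v # vs \<in> ordered_simplices X (k + 1) then 0 else \<phi> vs * \<phi> (vs[i := v]))"
    by (simp only: sum.distrib)
  also have "(\<Sum>vs\<in>ordered_simplices X k. \<Sum>v\<in>V. \<Sum>i<nat (k + 1).
          if v # vs \<in> ordered_simplices X (k + 1) then 0 else \<phi> vs * \<phi> (vs[i := v]))
      = (\<Sum>i<nat (k + 1). exchange_sum k \<phi> i)"
    unfolding exchange_sum_def by (rule sum_rotate)
  also have "\<dots> = (\<Sum>i<nat (k + 1). exchange_sum k \<phi> 0)"
    by (intro sum.cong refl exchange_sum_const[OF \<phi>]) auto
  also have "\<dots> = of_int (k + 1) * exchange_sum k \<phi> 0" using k by simp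
  finally show ?thesis .
qed

end

locale flag = finite_complex +
  assumes flag: "\<sigma> \<subseteq> V \<Longrightarrow> (\<And>u v. u \<in> \<sigma> \<Longrightarrow> v \<in> \<sigma> \<Longrightarrow> {u, v} \<in> X) \<Longrightarrow> \<sigma> \<in> X"
begin

lemma ordered_simplices_Cons_iff:
  assumes "vs \<in> ordered_simplices X k"
  shows "v # vs \<in> ordered_simplices X (k + 1)
    \<longleftrightarrow> {v} \<in> X \<and> (\<forall>w\<in>set vs. v \<noteq> w \<and> {v, w} \<in> X)"
proof
  assume "v # vs \<in> ordered_simplices X (k + 1)"
  then have "insert v (set vs) \<in> X" "v \<notin> set vs" by (auto simp: ordered_simplices_def)
  then show "{v} \<in> X \<and> (\<forall>w\<in>set vs. v \<noteq> w \<and> {v, w} \<in> X)"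
    using face[of "insert v (set vs)"] by auto
next
  assume v: "{v} \<in> X \<and> (\<forall>w\<in>set vs. v \<noteq> w \<and> {v, w} \<in> X)"
  have X: "set vs \<in> X" using assms by (simp add: ordered_simplices_def)
  have "insert v (set vs) \<in> X"
  proof (rule flag)
    show "insert v (set vs) \<subseteq> V" using v X simplex_subset by auto
    fix u w assume "u \<in> insert v (set vs)" "w \<in> insert v (set vs)"
    then show "{u, w} \<in> X"
      using v face[OF X, of "{u, w}"] by (auto simp: insert_commute)
  qed
  then show "v # vs \<in> ordered_simplices X (k + 1)"
    using assms v by (auto simp: ordered_simplices_def)
qed

lemma omit_in_ordered_simplices:
  assumes "vs \<in> ordered_simplices X k" "i < length vs"
  shows "omit i vs \<in> ordered_simplices X (k - 1)"
proof -
  have "vs ! i # omit i vs \<in> ordered_simplices X (k - 1 + 1)"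
    using ordered_simplices_cong[OF mset_front[OF assms(2)]] assms(1) by simp
  then show ?thesis by (rule ordered_simplices_tl)
qed

lemma set_eq_insert_omit:
  assumes "i < length vs"
  shows "set vs = insert (vs ! i) (set (omit i vs))"
  using mset_eq_setD[OF mset_front[OF assms]] by simp

text \<open>Two different facets cover the vertices of a simplex, so a vertex adjacent to both is adjacent to
  the whole simplex.\<close>

lemma facet_cone:
  assumes vs: "vs \<in> ordered_simplices X k" and ij: "i < length vs" "j < length vs" "i \<noteq> j"
    and "v # omit i vs \<in> ordered_simplices X k" "v # omit j vs \<in> ordered_simplices X k"
  shows "v # vs \<in> ordered_simplices X (k + 1)"
proof -
  have "vs ! i \<noteq> vs ! j"
    using vs ij by (simp add: ordered_simplices_def nth_eq_iff_index_eq)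
  then have "w \<in> set (omit i vs) \<or> w \<in> set (omit j vs)" if "w \<in> set vs" for w
    using that set_eq_insert_omit[OF ij(1)] set_eq_insert_omit[OF ij(2)] by (metis insert_iff)
  moreover have "{v} \<in> X \<and> (\<forall>w\<in>set (omit l vs). v \<noteq> w \<and> {v, w} \<in> X)" if "l \<in> {i, j}" for l
    using ordered_simplices_Cons_iff[OF omit_in_ordered_simplices[OF vs, of l], of v] assms that by auto
  ultimately show ?thesis
    unfolding ordered_simplices_Cons_iff[OF vs] by blast
qed

text \<open>The contribution of a single vertex \<open>v\<close> to the degrees of the \<open>k + 1\<close> facets: all facets if \<open>v\<close> extends
  the simplex, and otherwise at most one, by \<open>facet_cone\<close>. An entry of the simplex extends just the facet
  opposite to it.\<close>

lemma facet_degrees: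
  assumes k: "k \<ge> 0" and vs: "vs \<in> ordered_simplices X k"
  shows "(\<Sum>i<nat (k + 1). if v # omit i vs \<in> ordered_simplices X k then 1 else 0 :: real)
    \<le> (if v # vs \<in> ordered_simplices X (k + 1) then of_int k else 0) + 1"
proof -
  have len: "length vs = nat (k + 1)" using vs by (auto simp: ordered_simplices_def)
  define I where "I = {i. i < nat (k + 1) \<and> v # omit i vs \<in> ordered_simplices X k}"
  have fin: "finite I" by (simp add: I_def)
  have eq: "(\<Sum>i<nat (k + 1). if v # omit i vs \<in> ordered_simplices X k then 1 else 0 :: real) = card I"
    by (simp add: sum.If_cases I_def Int_def)
  show ?thesis
  proof (cases "v # vs \<in> ordered_simplices X (k + 1)")
    case True
    have "card I \<le> card {..<nat (k + 1)}" by (rule card_mono) (auto simp: I_def)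
    then have "real (card I) \<le> of_int k + 1" using k by simp
    then show ?thesis using True eq by simp
  next
    case False
    then have "\<forall>i\<in>I. \<forall>j\<in>I. i = j"
      using facet_cone[OF vs] by (auto simp: I_def len)
    then have "card I \<le> 1" using card_le_Suc0_iff_eq[OF fin] by simp
    then show ?thesis using False eq by simp
  qed
qed

text \<open>Applied to \<open>\<phi>\<^sub>u\<close>, the pointwise formula yields the exchanges at the positions after the first of \<open>vs = u # ws\<close>
  with those \<open>v\<close> for which \<open>v # ws\<close> is not a simplex. The exchange sums of \<open>\<phi>\<close> run over the larger set of
  \<open>v\<close> for which \<open>v # vs\<close> is not a simplex. The additional terms vanish: if \<open>v # ws\<close> is a simplex and
  \<open>vs\<close> with \<open>v\<close> in a later position is one, then \<open>v\<close> is adjacent to \<open>u\<close> and to all of \<open>ws\<close>, so \<open>v # vs\<close> is a simplex.\<close>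

lemma restrict_laplacian_form:
  assumes k: "k \<ge> 1" and \<phi>: "\<phi> \<in> cochains X k"
  shows "(\<Sum>u\<in>V. ordered_inner (k - 1) (\<lambda>ws. \<phi> (u # ws)) (laplacian X (k - 1) (\<lambda>ws. \<phi> (u # ws))))
    = degree_sum k \<phi> 0 + of_int k * exchange_sum k \<phi> 0"
proof -
  let ?S = "ordered_simplices X k"
  have len: "length vs = nat (k + 1)" if "vs \<in> ?S" for vs
    using that by (auto simp: ordered_simplices_def)
  define g where "g vs = (\<Sum>v\<in>V. if v # tl vs \<in> ?S then (\<phi> vs)\<^sup>2
      else (\<Sum>i<nat k. \<phi> vs * \<phi> (vs[Suc i := v])))" for vs
  have \<phi>': "(\<lambda>ws. \<phi> (u # ws)) \<in> cochains X (k - 1)" for u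
    using restrict_in_cochains[of \<phi> "k - 1" u] \<phi> by simp
  have "(\<Sum>u\<in>V. ordered_inner (k - 1) (\<lambda>ws. \<phi> (u # ws)) (laplacian X (k - 1) (\<lambda>ws. \<phi> (u # ws))))
      = (\<Sum>u\<in>V. \<Sum>ws\<in>ordered_simplices X (k - 1). g (u # ws))"
    unfolding ordered_inner_def
  proof (intro sum.cong refl)
    fix u ws assume ws: "ws \<in> ordered_simplices X (k - 1)"
    then have l: "length ws = nat k" by (auto simp: ordered_simplices_def)
    have "0 \<le> k - 1" using k by simp
    from laplacian_pointwise[OF this \<phi>' ws]
    show "\<phi> (u # ws) * laplacian X (k - 1) (\<lambda>ws. \<phi> (u # ws)) ws = g (u # ws)"
      by (auto simp: g_def l sum_distrib_left power2_eq_square intro!: sum.cong)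
  qed
  also have "\<dots> = (\<Sum>vs\<in>?S. g vs)"
  proof -
    have "g vs = 0" if "vs \<notin> ?S" for vs
    proof -
      have "\<phi> vs = 0" using that \<phi> by (simp add: cochains_iff)
      then show ?thesis by (auto simp: g_def intro!: sum.neutral)
    qed
    then show ?thesis using sum_Cons[of "k - 1" g] k by simp
  qed
  also have "\<dots> = (\<Sum>vs\<in>?S. (\<Sum>v\<in>V. if v # omit 0 vs \<in> ?S then (\<phi> vs)\<^sup>2 else 0)
      + (\<Sum>v\<in>V. \<Sum>i<nat k. if v # vs \<in> ordered_simplices X (k + 1) then 0
           else \<phi> vs * \<phi> (vs[Suc i := v])))"
    unfolding g_def sum.distrib[symmetric]
  proof (intro sum.cong refl)
    fix vs v assume vs: "vs \<in> ?S"
    then obtain u ws where uws: "vs = u # ws" using k by (cases vs) (auto simp: ordered_simplices_def)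
    have ws: "ws \<in> ordered_simplices X (k - 1)"
      using ordered_simplices_tl(2)[of u ws "k - 1"] vs uws by simp
    have cone: "v # ws \<in> ?S" if "v # vs \<in> ordered_simplices X (k + 1)"
      using that ordered_simplices_Cons_iff[OF vs] ordered_simplices_Cons_iff[OF ws, of v] uws by simp
    have zero: "\<phi> (vs[Suc i := v]) = 0"
      if "v # ws \<in> ?S" "v # vs \<notin> ordered_simplices X (k + 1)" "i < nat k" for i
    proof -
      have "vs[Suc i := v] \<notin> ?S"
      proof
        assume S: "vs[Suc i := v] \<in> ?S"
        have i: "i < length ws" using that(3) len[OF vs] uws k by simp
        then have "v \<in> set (ws[i := v])" by (simp add: set_update_memI)
        then have "u \<noteq> v" "{u, v} \<in> X"
          using S face[of "set (vs[Suc i := v])" "{u, v}"] uws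
          by (auto simp: ordered_simplices_def)
        then show False
          using that(1,2) ordered_simplices_Cons_iff[OF vs] ordered_simplices_Cons_iff[OF ws, of v] uws
          by (auto simp: insert_commute)
      qed
      then show ?thesis using \<phi> by (simp add: cochains_iff)
    qed
    show "(if v # tl vs \<in> ?S then (\<phi> vs)\<^sup>2 else (\<Sum>i<nat k. \<phi> vs * \<phi> (vs[Suc i := v])))
        = (if v # omit 0 vs \<in> ?S then (\<phi> vs)\<^sup>2 else 0)
          + (\<Sum>i<nat k. if v # vs \<in> ordered_simplices X (k + 1) then 0
               else \<phi> vs * \<phi> (vs[Suc i := v]))"
      using cone zero
      by (cases "v # ws \<in> ?S"; cases "v # vs \<in> ordered_simplices X (k + 1)")
        (auto simp: uws intro!: sum.neutral)
  qed
  also have "\<dots> = degree_sum k \<phi> 0 + (\<Sum>i<nat k. exchange_sum k \<phi> (Suc i))"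
    unfolding sum.distrib degree_sum_def exchange_sum_def
    by (rule arg_cong2[where f = "(+)", OF refl sum_rotate])
  also have "(\<Sum>i<nat k. exchange_sum k \<phi> (Suc i)) = (\<Sum>i<nat k. exchange_sum k \<phi> 0)"
    by (intro sum.cong refl exchange_sum_const[OF \<phi>]) auto
  also have "\<dots> = of_int k * exchange_sum k \<phi> 0" using k by simp
  finally show ?thesis .
qed

text \<open>The exchange parts on the two sides are both \<open>k (k + 1)\<close> times the same sum. What is left is the
  comparison of degrees, which \<open>facet_degrees\<close> makes vertex by vertex.\<close>

lemma restrict_energy_bound:
  assumes k: "k \<ge> 1" and \<phi>: "\<phi> \<in> cochains X k"
  shows "of_int (k + 1) * (\<Sum>u\<in>V. ordered_inner (k - 1) (\<lambda>ws. \<phi> (u # ws))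
      (laplacian X (k - 1) (\<lambda>ws. \<phi> (u # ws))))
    \<le> of_int k * ordered_inner k \<phi> (laplacian X k \<phi>) + of_nat (card V) * ordered_inner k \<phi> \<phi>"
proof -
  let ?S = "ordered_simplices X k"
  define d where "d = (\<Sum>vs\<in>?S. \<Sum>v\<in>V. if v # vs \<in> ordered_simplices X (k + 1) then (\<phi> vs)\<^sup>2 else 0)"
  have "of_int (k + 1) * degree_sum k \<phi> 0 = (\<Sum>i<nat (k + 1). degree_sum k \<phi> 0)"
    using k by simp
  also have "\<dots> = (\<Sum>i<nat (k + 1). degree_sum k \<phi> i)"
    by (intro sum.cong refl degree_sum_const[OF \<phi>, symmetric]) auto
  also have "\<dots> = (\<Sum>vs\<in>?S. \<Sum>v\<in>V. \<Sum>i<nat (k + 1). if v # omit i vs \<in> ?S then (\<phi> vs)\<^sup>2 else 0)"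
    unfolding degree_sum_def by (rule sum_rotate[symmetric])
  also have "\<dots> \<le> (\<Sum>vs\<in>?S. \<Sum>v\<in>V.
      of_int k * (if v # vs \<in> ordered_simplices X (k + 1) then (\<phi> vs)\<^sup>2 else 0) + (\<phi> vs)\<^sup>2)"
  proof (intro sum_mono)
    fix vs v assume vs: "vs \<in> ?S"
    have "(\<Sum>i<nat (k + 1). if v # omit i vs \<in> ?S then (\<phi> vs)\<^sup>2 else 0)
        = (\<phi> vs)\<^sup>2 * (\<Sum>i<nat (k + 1). if v # omit i vs \<in> ?S then 1 else 0)"
      unfolding sum_distrib_left by (intro sum.cong) auto
    also have "\<dots> \<le> (\<phi> vs)\<^sup>2 * ((if v # vs \<in> ordered_simplices X (k + 1) then of_int k else 0) + 1)"
      using facet_degrees[OF _ vs, of v] k by (intro mult_left_mono) auto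
    finally show "(\<Sum>i<nat (k + 1). if v # omit i vs \<in> ?S then (\<phi> vs)\<^sup>2 else 0)
        \<le> of_int k * (if v # vs \<in> ordered_simplices X (k + 1) then (\<phi> vs)\<^sup>2 else 0) + (\<phi> vs)\<^sup>2"
      by (simp add: algebra_simps split: if_splits)
  qed
  also have "\<dots> = of_int k * d + of_nat (card V) * ordered_inner k \<phi> \<phi>"
    unfolding d_def ordered_inner_def
    by (simp only: sum.distrib sum_distrib_left sum_constant power2_eq_square)
  finally have "of_int (k + 1) * degree_sum k \<phi> 0
      \<le> of_int k * d + of_nat (card V) * ordered_inner k \<phi> \<phi>" .
  moreover have "ordered_inner k \<phi> (laplacian X k \<phi>) = d + of_int (k + 1) * exchange_sum k \<phi> 0"
    unfolding d_def by (rule laplacian_form) (use k \<phi> in auto)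
  ultimately show ?thesis
    unfolding restrict_laplacian_form[OF k \<phi>] by (simp add: algebra_simps)
qed

theorem min_eigenvalue_bound:
  assumes k: "k \<ge> 1" and ne: "laplacian_eigenvalues X k \<noteq> {}"
  shows "laplacian_eigenvalues X (k - 1) \<noteq> {}"
    and "of_int (k + 1) * Min (laplacian_eigenvalues X (k - 1)) - of_nat (card V)
      \<le> of_int k * Min (laplacian_eigenvalues X k)"
proof -
  let ?\<mu> = "Min (laplacian_eigenvalues X k)" and ?\<nu> = "Min (laplacian_eigenvalues X (k - 1))"
  have "?\<mu> \<in> laplacian_eigenvalues X k"
    using finite_laplacian_eigenvalues[of k] k ne by (intro Min_in) auto
  then obtain \<phi> where \<phi>: "\<phi> \<in> cochains X k" "\<phi> \<noteq> (\<lambda>vs. 0)"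
    and eig: "laplacian X k \<phi> = (\<lambda>vs. ?\<mu> * \<phi> vs)"
    unfolding laplacian_eigenvalues_def by blast
  have res: "(\<lambda>ws. \<phi> (u # ws)) \<in> cochains X (k - 1)" for u
    using restrict_in_cochains[of \<phi> "k - 1" u] \<phi> by simp
  obtain vs where vs: "\<phi> vs \<noteq> 0" using \<phi>(2) by (auto simp: fun_eq_iff)
  then have "vs \<in> ordered_simplices X k" using \<phi>(1) by (auto simp: cochains_iff)
  then obtain u ws where "vs = u # ws" using k by (cases vs) (auto simp: ordered_simplices_def)
  then have nz: "(\<lambda>ws. \<phi> (u # ws)) \<noteq> (\<lambda>ws. 0)" using vs by (auto simp: fun_eq_iff)
  have k1: "k - 1 \<ge> 0" using k by simp
  show "laplacian_eigenvalues X (k - 1) \<noteq> {}"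
    by (rule rayleigh_laplacian(1)[OF k1 res nz])
  let ?N = "ordered_inner k \<phi> \<phi>"
  have "?N \<noteq> 0" using ordered_inner_zero[OF \<phi>(1)] vs by blast
  moreover have "?N \<ge> 0" by (simp add: ordered_inner_def sum_nonneg)
  ultimately have pos: "?N > 0" by simp
  have "?\<nu> * ?N = (\<Sum>u\<in>V. ?\<nu> * ordered_inner (k - 1) (\<lambda>ws. \<phi> (u # ws)) (\<lambda>ws. \<phi> (u # ws)))"
    using ordered_inner_restrict[of "k - 1" \<phi>] \<phi>(1) k by (simp add: sum_distrib_left[symmetric])
  also have "\<dots> \<le> (\<Sum>u\<in>V. ordered_inner (k - 1) (\<lambda>ws. \<phi> (u # ws))
      (laplacian X (k - 1) (\<lambda>ws. \<phi> (u # ws))))"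
    by (intro sum_mono rayleigh_laplacian(2)[OF k1 res nz res])
  finally have "of_int (k + 1) * (?\<nu> * ?N) \<le> of_int (k + 1) * (\<Sum>u\<in>V. ordered_inner (k - 1)
      (\<lambda>ws. \<phi> (u # ws)) (laplacian X (k - 1) (\<lambda>ws. \<phi> (u # ws))))"
    using k by (intro mult_left_mono) auto
  also have "\<dots> \<le> of_int k * ordered_inner k \<phi> (laplacian X k \<phi>) + of_nat (card V) * ?N"
    by (rule restrict_energy_bound[OF k \<phi>(1)])
  also have "ordered_inner k \<phi> (laplacian X k \<phi>) = ?\<mu> * ?N"
    by (simp add: eig ordered_inner_def sum_distrib_left algebra_simps)
  finally have "(of_int (k + 1) * ?\<nu> - of_nat (card V)) * ?N \<le> (of_int k * ?\<mu>) * ?N"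
    by (simp add: algebra_simps)
  then show "of_int (k + 1) * ?\<nu> - of_nat (card V) \<le> of_int k * ?\<mu>"
    using pos by (simp only: mult_le_cancel_right_pos)
qed

end

lemma flag_flag_complex:
  assumes "graph G"
  shows "flag (flag_complex G) (verts G)"
proof -
  interpret graph G by (rule assms)
  show ?thesis
    by unfold_locales (auto simp: flag_complex_def)
qed

theorem theorem1p1:
  fixes G :: "('a, 'b) pre_digraph" and n :: nat and k :: int
  assumes "graph G"
    and "card (verts G) = n"
    and "k \<ge> 1"
  shows "ereal (of_int k) * min_laplacian_eigenvalue G k
           \<ge> ereal (of_int (k + 1)) * min_laplacian_eigenvalue G (k - 1) - ereal (of_nat n)"
proof (cases "laplacian_eigenvalues (flag_complex G) k = {}")
  case True
  then have infinite: "ereal (of_int k) * min_laplacian_eigenvalue G k = \<infinity>"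
    using assms(3) by (simp add: min_laplacian_eigenvalue_def)
  show ?thesis unfolding infinite by simp
next
  case False
  interpret flag "flag_complex G" "verts G" by (rule flag_flag_complex[OF assms(1)])
  show ?thesis
    using min_eigenvalue_bound[OF assms(3) False] False assms(2)
    by (simp add: min_laplacian_eigenvalue_def)
qed

end
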